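(* Fix $n\in\mathbb{N}^*$ and $T>0$. Let $K:[0,1]^2\to\mathbb{R}$ be a symmetric, nonnegative, bounded measurable function with cell averages $(\hat K_n)_{ij}$, and let $g^0=(g_i^0)_{i}\in\mathbb{R}^n$. Suppose that $\mathrm{supp}(\hat K_n)\neq\emptyset$ and $g^0\in S_\infty$. For $p\in(1,+\infty)$ let $\check U^p:[0,T]\to\mathbb{R}^n$ be the piecewise linear in time interpolation of the solution of the fully discrete problem $$\frac{U_{i,h}^p-U_{i,h-1}^p}{\tau_{h-1}}=\frac1n\sum_{j=1}^n(\hat K_n)_{ij}\,|U_{j,h-1}^p-U_{i,h-1}^p|^{p-2}(U_{j,h-1}^p-U_{i,h-1}^p),\quad 1\le i\le n,\ 1\le h\le N,\qquad U^p_{i,0}=g_i^0 .$$ If $U^\infty$ is the unique solution of $$\frac{dU^\infty}{dt}(t)+\mathrm N_{S_\infty}(U^\infty(t))\ni0,\quad t\in(0,T],\qquad U_i^\infty(0)=g_i^0,\ 1\le i\le n,$$ then $$\lim_{p\to\infty}\ \lim_{\tau\to0}\ \sup_{t\in[0,T]}|\check U^p(t)-U^\infty(t)|=0 .$$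
   Context: With $\Omega_i^{(n)}=[\frac{i-1}n,\frac in)$, $(\hat K_n)_{ij}=n^2\int_{\Omega_i^{(n)}\times\Omega_j^{(n)}}K(x,y)\,dx\,dy$, and $\mathrm{supp}(\hat K_n)=\{(i,j):(\hat K_n)_{ij}\neq0\}$. The time grid is a partition $0=t_0<t_1<\dots<t_N=T$, $\tau_{h-1}=|t_h-t_{h-1}|$, and $\tau=\max_h\tau_h$ is its maximal step size. With $U_h^p=(U_{i,h}^p)_i\in\mathbb{R}^n$, $$\check U^p(t)=\frac{t_h-t}{\tau_{h-1}}U_{h-1}^p+\frac{t-t_{h-1}}{\tau_{h-1}}U_h^p,\quad t\in(t_{h-1},t_h],\qquad \check U^p(0)=g^0.$$ $S_\infty=\{v\in\mathbb{R}^n:|v_j-v_i|\le1\ \text{for all}\ (i,j)\in\mathrm{supp}(\hat K_n)\}$, a non-empty closed convex set. Its normal cone is $\mathrm N_{S_\infty}(v)=\{\eta\in\mathbb{R}^n:\langle\eta,w-v\rangle\le0\ \forall w\in S_\infty\}$ if $v\in S_\infty$, and $\mathrm N_{S_\infty}(v)=\emptyset$ otherwise. $|\cdot|$ is the Euclidean norm on $\mathbb{R}^n$. *)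

theory Defs
  imports "HOL-Analysis.Analysis"
begin

text \<open>
  \<open>\<real>\<^sup>n\<close> is \<open>real ^ 'n\<close> with \<open>n = CARD('n)\<close>. Since the cells are ordered along \<open>[0,1]\<close>, coordinates
  carry an enumeration \<open>idx :: 'n \<Rightarrow> nat\<close>, intended to be a bijection onto \<open>{1..n}\<close>.
\<close>

definition cell :: "nat \<Rightarrow> nat \<Rightarrow> real set" where
  "cell n i = {(real i - 1) / real n ..< real i / real n}"

definition cell_avg :: "(real \<Rightarrow> real \<Rightarrow> real) \<Rightarrow> nat \<Rightarrow> nat \<Rightarrow> nat \<Rightarrow> real" where
  "cell_avg K n i j =
     (real n)\<^sup>2 * set_lebesgue_integral lebesgue (cell n i \<times> cell n j) (\<lambda>(x, y). K x y)"

definition K_hat :: "('n::finite \<Rightarrow> nat) \<Rightarrow> (real \<Rightarrow> real \<Rightarrow> real) \<Rightarrow> 'n \<Rightarrow> 'n \<Rightarrow> real" where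
  "K_hat idx K i j = cell_avg K CARD('n) (idx i) (idx j)"

definition supp :: "('n \<Rightarrow> 'n \<Rightarrow> real) \<Rightarrow> ('n \<times> 'n) set" where
  "supp A = {(i, j). A i j \<noteq> 0}"

definition S_inf :: "('n::finite \<Rightarrow> 'n \<Rightarrow> real) \<Rightarrow> (real ^ 'n) set" where
  "S_inf A = {v. \<forall>(i, j) \<in> supp A. \<bar>v $ j - v $ i\<bar> \<le> 1}"

definition normal_cone :: "'a::real_inner set \<Rightarrow> 'a \<Rightarrow> 'a set" where
  "normal_cone S v = (if v \<in> S then {\<eta>. \<forall>w\<in>S. \<eta> \<bullet> (w - v) \<le> 0} else {})"

text \<open>
  A pair \<open>(N, t)\<close> encodes the grid \<open>0 = t 0 < \<dots> < t N = T\<close>; the values of \<open>t\<close> beyond \<open>N\<close> play no role.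
\<close>

type_synonym grid = "nat \<times> (nat \<Rightarrow> real)"

definition grids :: "real \<Rightarrow> grid set" where
  "grids T = {(N, t). t 0 = 0 \<and> t N = T \<and> (\<forall>h<N. t h < t (Suc h))}"

definition step :: "(nat \<Rightarrow> real) \<Rightarrow> nat \<Rightarrow> real" where
  "step t h = \<bar>t (Suc h) - t h\<bar>"

definition max_step :: "grid \<Rightarrow> real" where
  "max_step = (\<lambda>(N, t). Max (step t ` {..<N}))"

text \<open>The filter expressing \<open>\<tau> \<rightarrow> 0\<close>, uniformly over all grids of \<open>[0,T]\<close> with maximal step \<open>\<tau>\<close>.\<close>

definition refining :: "real \<Rightarrow> grid filter" where
  "refining T = inf (filtercomap max_step (at_right 0)) (principal (grids T))"

text \<open>
  At \<open>U h $ j = U h $ i\<close> the flux \<open>\<bar>x\<bar>\<^sup>p\<^sup>-\<^sup>2 x\<close> is \<open>0\<close>, also for \<open>p < 2\<close>, because \<open>0 powr a = 0\<close>.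
\<close>

definition solves_scheme ::
  "('n::finite \<Rightarrow> 'n \<Rightarrow> real) \<Rightarrow> real ^ 'n \<Rightarrow> real \<Rightarrow> grid \<Rightarrow> (nat \<Rightarrow> real ^ 'n) \<Rightarrow> bool" where
  "solves_scheme A g p = (\<lambda>(N, t) U.
     U 0 = g \<and>
     (\<forall>h\<in>{1..N}. \<forall>i.
        (U h $ i - U (h - 1) $ i) / step t (h - 1) =
        1 / real CARD('n) * (\<Sum>j\<in>UNIV.
          A i j * \<bar>U (h - 1) $ j - U (h - 1) $ i\<bar> powr (p - 2) * (U (h - 1) $ j - U (h - 1) $ i))))"

definition interp :: "grid \<Rightarrow> (nat \<Rightarrow> 'a::real_vector) \<Rightarrow> real \<Rightarrow> 'a" where
  "interp = (\<lambda>(N, t) U s.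
     if s = 0 then U 0
     else let h = (THE h. h \<in> {1..N} \<and> s \<in> {t (h - 1) <.. t h}) in
       ((t h - s) / step t (h - 1)) *\<^sub>R U (h - 1) + ((s - t (h - 1)) / step t (h - 1)) *\<^sub>R U h)"

text \<open>
  Strong solutions (in the sense of Brezis) of \<open>u' + \<A> u \<ni> 0\<close>, \<open>u 0 = g\<close> on \<open>[0,T]\<close>: \<open>u\<close> is continuous
  on \<open>[0,T]\<close>, absolutely continuous on compact subintervals of \<open>(0,T)\<close>, and the inclusion holds almost
  everywhere. Absolute continuity is expressed by \<open>u\<close> being the integral of its a.e. derivative \<open>u'\<close>.
\<close>

definition strong_solution ::
  "('a::euclidean_space \<Rightarrow> 'a set) \<Rightarrow> 'a \<Rightarrow> real \<Rightarrow> (real \<Rightarrow> 'a) \<Rightarrow> bool" where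
  "strong_solution \<A> g T u \<longleftrightarrow>
     u 0 = g \<and> continuous_on {0..T} u \<and>
     (\<exists>u'.
        (\<forall>a b. 0 < a \<and> a \<le> b \<and> b < T \<longrightarrow>
           u' absolutely_integrable_on {a..b} \<and> u b - u a = integral {a..b} u') \<and>
        (AE t in lebesgue. t \<in> {0<..<T} \<longrightarrow>
           (u has_vector_derivative u' t) (at t) \<and> 0 \<in> (\<lambda>\<eta>. u' t + \<eta>) ` \<A> (u t)))"

end

theory Submission
  imports Defs
begin

text \<open>
  Since the initial datum \<open>g\<close> lies in \<open>S\<^sub>\<infinity>\<close>, the constant \<open>g\<close> solves the limit inclusion, and
  monotonicity of the normal cone makes it the only solution
  (\<open>strong_solution_normal_cone_const\<close>). The claim is therefore that the scheme hardly moves away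
  from \<open>g\<close> when \<open>p\<close> is large.

  By symmetry of the cell averages, the scheme is the explicit Euler method for \<open>u' = f u\<close>, where
  \<open>f = - grad E\<close> and
  \<open>E u = 1 / (2 n p) * (\<Sum>i j. A i j * \<bar>u j - u i\<bar>\<^sup>p)\<close> is convex. All that is used of
  convexity is the subgradient inequality \<open>f u \<bullet> (u - v) \<le> E v - E u\<close>
  (\<open>p_laplacian_subgradient\<close>); it holds for every \<open>p > 1\<close>, although \<open>f\<close> is not
  Lipschitz for \<open>p < 2\<close>. It has two consequences.

  With \<open>v = g\<close> it shows that one Euler step of length \<open>d\<close> increases \<open>\<bar>u - g\<bar>\<^sup>2\<close>
  by at most \<open>2 d E g + d\<^sup>2 \<bar>f u\<bar>\<^sup>2\<close>. On sufficiently fine grids the iterates thus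
  stay in a fixed ball, on which \<open>\<bar>f\<bar> \<le> M\<close>, and satisfy
  \<open>\<bar>u - g\<bar>\<^sup>2 \<le> 2 T E g + T \<tau> M\<^sup>2\<close> (\<open>euler_dist\<close>).

  Adding the inequality for \<open>(u, v)\<close> and \<open>(v, u)\<close> shows that \<open>f\<close> is dissipative. Two
  interpolants \<open>u\<close>, \<open>v\<close> of Euler iterates on grids with maximal steps \<open>\<tau>\<close>, \<open>\<tau>'\<close>
  differ from the iterates at which \<open>f\<close> was evaluated by at most \<open>\<tau> M\<close> and \<open>\<tau>' M\<close>, so
  \<open>\<bar>u - v\<bar>\<^sup>2 \<le> 4 M\<^sup>2 (\<tau> + \<tau>') T\<close> (\<open>interp_euler_diff\<close>). Hence the
  interpolants are uniformly Cauchy as the grids are refined, and the inner limit \<open>L p\<close> exists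
  without first solving the differential equation \<open>u' = f u\<close>.

  Passing to the limit in the first consequence, \<open>L p \<le> sqrt (2 T E g)\<close> (\<open>euler_limit\<close>). As the differences of \<open>g\<close> along the
  support of \<open>A\<close> are at most 1 in absolute value, \<open>E g\<close> is at most a constant divided by \<open>p\<close>
  (\<open>p_energy_le_S_inf\<close>), so \<open>L p\<close> tends to 0.
\<close>

section \<open>The limit problem\<close>

text \<open>
  Chaining steps shorter than \<open>\<delta>\<close>. With it, an inequality that is only available up to the
  oscillation of a continuous function on short intervals becomes a global one.
\<close>

lemma locally_nonincreasing_imp_le:
  fixes F :: "real \<Rightarrow> real"
  assumes "\<delta> > 0" "a \<le> b"
    and dec: "\<And>s t. a \<le> s \<Longrightarrow> s \<le> t \<Longrightarrow> t \<le> b \<Longrightarrow> t - s < \<delta> \<Longrightarrow> F t \<le> F s"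
  shows "F b \<le> F a"
proof -
  have "F t \<le> F a" if "a \<le> t" "t \<le> b" "t - a \<le> real n * (\<delta> / 2)" for n t
    using that
  proof (induction n arbitrary: t)
    case 0
    then show ?case by simp
  next
    case (Suc n)
    define s where "s = max a (t - \<delta> / 2)"
    have "F t \<le> F s"
      using Suc.prems \<open>\<delta> > 0\<close> by (intro dec) (auto simp: s_def)
    also have "F s \<le> F a"
      using Suc.prems \<open>\<delta> > 0\<close> by (intro Suc.IH) (auto simp: s_def max_def field_simps)
    finally show ?case .
  qed
  moreover obtain n where "b - a \<le> real n * (\<delta> / 2)"
    using reals_Archimedean3[of "\<delta> / 2"] \<open>\<delta> > 0\<close> by (meson half_gt_zero less_imp_le)
  ultimately show ?thesis using \<open>a \<le> b\<close> by blast
qed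

text \<open>
  Formally the squared distance has derivative \<open>2 u' \<bullet> (u - g) \<le> 0\<close>. To avoid a product rule
  for absolutely continuous functions, the increment over \<open>[s, t]\<close> is written as
  \<open>(u t - u s) \<bullet> (u t + u s - 2 g)\<close>, that is, as the integral of
  \<open>u' r \<bullet> (u t + u s - 2 g)\<close>. Replacing \<open>u t + u s\<close> by \<open>2 u r\<close> costs at most
  \<open>2 \<epsilon> \<bar>u' r\<bar>\<close> if \<open>u\<close> oscillates by less than \<open>\<epsilon>\<close> on \<open>[s, t]\<close>; these errors
  add up to \<open>2 \<epsilon>\<close> times the total variation, which vanishes as \<open>\<epsilon>\<close> tends to 0.
\<close>

lemma strong_solution_normal_cone_dist_le:
  fixes u u' :: "real \<Rightarrow> 'a::euclidean_space"
  assumes u': "u' absolutely_integrable_on {a..b}"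
    and ftc: "\<And>s t. a \<le> s \<Longrightarrow> s \<le> t \<Longrightarrow> t \<le> b \<Longrightarrow> u t - u s = integral {s..t} u'"
    and cont: "continuous_on {a..b} u"
    and null: "negligible N"
    and inc: "\<And>t. t \<in> {a..b} - N \<Longrightarrow> u' t \<bullet> (u t - g) \<le> 0"
    and "a \<le> b"
  shows "(norm (u b - g))\<^sup>2 \<le> (norm (u a - g))\<^sup>2"
proof -
  define I where "I t = integral {a..t} (\<lambda>r. norm (u' r))" for t
  have int: "u' integrable_on {s..t}" "(\<lambda>r. norm (u' r)) integrable_on {s..t}" if "a \<le> s" "t \<le> b" for s t
    using absolutely_integrable_on_subinterval[OF u', of s t] that
    by (auto simp: absolutely_integrable_on_def)
  have bound: "(norm (u b - g))\<^sup>2 \<le> (norm (u a - g))\<^sup>2 + 2 * \<epsilon> * I b" if "\<epsilon> > 0" for \<epsilon>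
  proof -
    have "uniformly_continuous_on {a..b} u"
      using cont by (intro compact_uniformly_continuous) auto
    then obtain \<delta> where "\<delta> > 0"
      and \<delta>: "\<And>s t. s \<in> {a..b} \<Longrightarrow> t \<in> {a..b} \<Longrightarrow> dist t s < \<delta> \<Longrightarrow> dist (u t) (u s) < \<epsilon>"
      unfolding uniformly_continuous_on_def using \<open>\<epsilon> > 0\<close> by metis
    have "(norm (u t - g))\<^sup>2 - 2 * \<epsilon> * I t \<le> (norm (u s - g))\<^sup>2 - 2 * \<epsilon> * I s"
      if st: "a \<le> s" "s \<le> t" "t \<le> b" "t - s < \<delta>" for s t
    proof -
      define c where "c = u t + u s - 2 *\<^sub>R g"
      \<comment> \<open>\<open>f\<close> is the integrand, altered on the null set so that the estimate holds everywhere.\<close>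
      define f where "f r = (if r \<in> N then 2 * \<epsilon> * norm (u' r) else u' r \<bullet> c)" for r
      have ibl: "(\<lambda>r. u' r \<bullet> c) integrable_on {s..t}"
        using int(1)[of s t] st  integrable_linear[OF _ bounded_linear_inner_left[of c]] by (simp add: o_def)
      have "(norm (u t - g))\<^sup>2 - (norm (u s - g))\<^sup>2 = (u t - u s) \<bullet> c"
        by (simp add: c_def power2_norm_eq_inner inner_simps inner_commute)
      also have "\<dots> = integral {s..t} (\<lambda>r. u' r \<bullet> c)"
        using ftc[of s t] st integral_linear[OF int(1)[of s t] bounded_linear_inner_left[of c]]
        by (simp add: o_def)
      also have "\<dots> = integral {s..t} f"
        by (rule integral_spike[OF null]) (auto simp: f_def)
      also have "\<dots> \<le> integral {s..t} (\<lambda>r. 2 * \<epsilon> * norm (u' r))"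
      proof (rule integral_le)
        show "f integrable_on {s..t}"
          by (rule integrable_spike[OF ibl null]) (auto simp: f_def)
        show "(\<lambda>r. 2 * \<epsilon> * norm (u' r)) integrable_on {s..t}"
          using int(2)[of s t] st by (intro integrable_on_mult_right) auto
        fix r assume r: "r \<in> {s..t}"
        show "f r \<le> 2 * \<epsilon> * norm (u' r)"
        proof (cases "r \<in> N")
          case False
          have "norm ((u t - u r) + (u s - u r)) \<le> 2 * \<epsilon>"
            using \<delta>[of r t] \<delta>[of r s] r st norm_triangle_ineq[of "u t - u r" "u s - u r"]
            by (auto simp: dist_norm)
          then have "u' r \<bullet> ((u t - u r) + (u s - u r)) \<le> norm (u' r) * (2 * \<epsilon>)"
            by (intro order_trans[OF norm_cauchy_schwarz] mult_left_mono) auto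
          moreover have "u' r \<bullet> c = 2 * (u' r \<bullet> (u r - g)) + u' r \<bullet> ((u t - u r) + (u s - u r))"
            by (simp add: c_def inner_simps)
          moreover have "u' r \<bullet> (u r - g) \<le> 0"
            using inc r st False by auto
          ultimately show ?thesis using False by (simp add: f_def mult_ac)
        qed (simp add: f_def)
      qed
      also have "\<dots> = 2 * \<epsilon> * integral {s..t} (\<lambda>r. norm (u' r))" by simp
      also have "integral {s..t} (\<lambda>r. norm (u' r)) = I t - I s"
        using Henstock_Kurzweil_Integration.integral_combine[of a s t "\<lambda>r. norm (u' r)"] int(2)[of a t] st
        by (simp add: I_def)
      finally show ?thesis by (simp add: algebra_simps)
    qed
    then have "(norm (u b - g))\<^sup>2 - 2 * \<epsilon> * I b \<le> (norm (u a - g))\<^sup>2 - 2 * \<epsilon> * I a"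
      using locally_nonincreasing_imp_le[of \<delta> a b "\<lambda>t. (norm (u t - g))\<^sup>2 - 2 * \<epsilon> * I t"]
        \<open>\<delta> > 0\<close> \<open>a \<le> b\<close> by blast
    then show ?thesis by (simp add: I_def)
  qed
  have "I b \<ge> 0"
    using int(2)[of a b] by (simp add: I_def integral_nonneg)
  show ?thesis
  proof (rule field_le_epsilon)
    fix e :: real assume "e > 0"
    have "2 * (e / (2 * (I b + 1))) * I b \<le> e"
      using \<open>e > 0\<close> \<open>I b \<ge> 0\<close> by (simp add: field_simps)
    with bound[of "e / (2 * (I b + 1))"] \<open>e > 0\<close> \<open>I b \<ge> 0\<close>
    show "(norm (u b - g))\<^sup>2 \<le> (norm (u a - g))\<^sup>2 + e"
      by (smt (verit) divide_pos_pos)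
  qed
qed

text \<open>
  A solution that starts in \<open>S\<close> does not move: \<open>- u' t\<close> lies in the normal cone at \<open>u t\<close>, so
  testing with \<open>g \<in> S\<close> gives \<open>u' t \<bullet> (u t - g) \<le> 0\<close>, and the distance to \<open>g\<close>, initially 0,
  cannot increase. The integral representation of \<open>u\<close> holds only away from the endpoints of
  \<open>[0, T]\<close>, which are reached by continuity.
\<close>

lemma strong_solution_normal_cone_const:
  fixes u :: "real \<Rightarrow> 'a::euclidean_space"
  assumes sol: "strong_solution (normal_cone S) g T u" and "g \<in> S" and "t \<in> {0..T}"
  shows "u t = g"
proof (cases "T = 0")
  case True
  then show ?thesis using sol \<open>t \<in> {0..T}\<close> by (auto simp: strong_solution_def)
next
  case False
  define \<phi> where "\<phi> t = (norm (u t - g))\<^sup>2" for t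
  have "T > 0" using False \<open>t \<in> {0..T}\<close> by auto
  from sol obtain u' where u0: "u 0 = g" and cont: "continuous_on {0..T} u"
    and u': "\<And>a b. 0 < a \<Longrightarrow> a \<le> b \<Longrightarrow> b < T \<Longrightarrow>
           u' absolutely_integrable_on {a..b} \<and> u b - u a = integral {a..b} u'"
    and ae: "AE t in lebesgue. t \<in> {0<..<T} \<longrightarrow>
           (u has_vector_derivative u' t) (at t) \<and> 0 \<in> (\<lambda>\<eta>. u' t + \<eta>) ` normal_cone S (u t)"
    unfolding strong_solution_def by blast
  define P where "P t \<longleftrightarrow> 0 \<in> (\<lambda>\<eta>. u' t + \<eta>) ` normal_cone S (u t)" for t
  have "AE t in lebesgue. t \<in> {0<..<T} \<longrightarrow> P t"
    using ae by eventually_elim (simp add: P_def)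
  then obtain N where N: "N \<in> null_sets lebesgue" and sub: "{t. \<not> (t \<in> {0<..<T} \<longrightarrow> P t)} \<subseteq> N"
    unfolding eventually_ae_filter by auto
  have "negligible N" using N by (simp add: negligible_iff_null_sets)
  have inc: "u' t \<bullet> (u t - g) \<le> 0" if t: "t \<in> {0<..<T} - N" for t
  proof -
    have "P t" using sub t by blast
    then obtain \<eta> where "u' t + \<eta> = 0" "\<eta> \<in> normal_cone S (u t)"
      unfolding P_def by force
    then have "\<eta> = - u' t" "\<eta> \<bullet> (g - u t) \<le> 0"
      using \<open>g \<in> S\<close> by (auto simp: normal_cone_def add_eq_0_iff2 split: if_splits)
    then show ?thesis by (simp add: inner_diff_right)
  qed
  have dec: "\<phi> b \<le> \<phi> a" if "0 < a" "a \<le> b" "b < T" for a b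
    unfolding \<phi>_def
  proof (rule strong_solution_normal_cone_dist_le[where u' = u' and N = N])
    show "continuous_on {a..b} u"
      using cont by (rule continuous_on_subset) (use that in auto)
    show "u' absolutely_integrable_on {a..b}"
      using u' that by blast
    show "u t - u s = integral {s..t} u'" if "a \<le> s" "s \<le> t" "t \<le> b" for s t
      using u'[of s t] that \<open>0 < a\<close> \<open>b < T\<close> by linarith
    show "u' t \<bullet> (u t - g) \<le> 0" if "t \<in> {a..b} - N" for t
      using inc[of t] that \<open>0 < a\<close> \<open>b < T\<close> by simp
  qed (rule \<open>negligible N\<close>, rule \<open>a \<le> b\<close>)
  have cont_\<phi>: "continuous_on {0..T} \<phi>"
    unfolding \<phi>_def by (intro continuous_intros cont)
  have "\<phi> s \<le> 0" if "s \<in> {0<..<T}" for s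
  proof -
    have "\<phi> 0 \<ge> \<phi> s"
    proof (rule continuous_ge_on_closure[where S = "{0<..<s}" and f = \<phi>])
      show "continuous_on (closure {0<..<s}) \<phi>"
        using that by (intro continuous_on_subset[OF cont_\<phi>]) auto
    next
      fix r assume "r \<in> {0<..<s}"
      then show "\<phi> s \<le> \<phi> r" using dec[of r s] that by simp
    qed (use that in simp)
    then show ?thesis by (simp add: \<phi>_def u0)
  qed
  then have "\<phi> t \<le> 0"
    using continuous_le_on_closure[of "{0<..<T}" \<phi> t 0] cont_\<phi> \<open>T > 0\<close> \<open>t \<in> {0..T}\<close> by simp
  then show ?thesis by (simp add: \<phi>_def)
qed

section \<open>Grids and piecewise linear interpolation\<close>

lemma eventually_refining:
  assumes "\<delta> > 0"
  shows "eventually (\<lambda>G. G \<in> grids T \<and> max_step G < \<delta>) (refining T)"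
proof -
  have "eventually (\<lambda>x. x < \<delta>) (at_right (0::real))"
    using eventually_at_right_real[OF assms] by eventually_elim simp
  then have "eventually (\<lambda>G. max_step G < \<delta>) (filtercomap max_step (at_right 0))"
    by (rule eventually_filtercomapI)
  then show ?thesis
    unfolding refining_def eventually_inf_principal by eventually_elim simp
qed

text \<open>
  Uniform grids are arbitrarily fine. This is what allows bounds to pass to limits along
  \<open>refining T\<close>.
\<close>

lemma refining_neq_bot:
  assumes "T > 0"
  shows "refining T \<noteq> bot"
proof
  assume "refining T = bot"
  then have "eventually (\<lambda>G. False) (refining T)" by simp
  then obtain Q where "eventually Q (at_right (0::real))"
    and Q: "\<And>G. Q (max_step G) \<Longrightarrow> G \<notin> grids T"
    unfolding refining_def eventually_inf_principal eventually_filtercomap by auto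
  then obtain \<delta> where "\<delta> > 0" and \<delta>: "\<And>x. 0 < x \<Longrightarrow> x < \<delta> \<Longrightarrow> Q x"
    by (auto simp: eventually_at_right_field)
  obtain N where N: "N > 0" "T < real N * \<delta>"
    using reals_Archimedean3[OF \<open>\<delta> > 0\<close>] \<open>T > 0\<close>
    by (metis gr0I mult_zero_left not_less_iff_gr_or_eq of_nat_0)
  define t where "t h = real h * T / real N" for h
  have step: "step t h = T / real N" for h
    using \<open>T > 0\<close> by (simp add: step_def t_def diff_divide_distrib[symmetric] algebra_simps)
  have "step t ` {..<N} = {T / real N}"
    using N(1) by (auto simp: step image_iff)
  then have max: "max_step (N, t) = T / real N" by (simp add: max_step_def)
  have "t h < t (Suc h)" for h
    using \<open>T > 0\<close> N(1) by (simp add: t_def divide_strict_right_mono)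
  then have "(N, t) \<in> grids T"
    using N(1) by (simp add: grids_def t_def)
  moreover have "Q (max_step (N, t))"
    using \<open>T > 0\<close> N by (intro \<delta>) (auto simp: max field_simps)
  ultimately show False using Q by blast
qed

lemma grid_mono:
  assumes "(N, t) \<in> grids T" "i \<le> j" "j \<le> N"
  shows "t i \<le> t j"
  using assms(2,3)
proof (induction j rule: dec_induct)
  case (step j)
  then have "t j < t (Suc j)" using assms(1) by (auto simp: grids_def)
  with step show ?case by auto
qed simp

lemma grid_bounds:
  assumes "(N, t) \<in> grids T" "h \<le> N"
  shows "t h \<in> {0..T}"
  using grid_mono[OF assms(1), of 0 h] grid_mono[OF assms(1), of h N] assms by (auto simp: grids_def)

lemma grid_step_le:
  assumes "(N, t) \<in> grids T" "h < N"
  shows "t (Suc h) - t h \<le> max_step (N, t)"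
proof -
  have "step t h \<le> max_step (N, t)"
    using assms(2) by (auto simp: max_step_def intro: Max_ge)
  then show ?thesis by (simp add: step_def)
qed

lemma max_step_nonneg:
  assumes "(N, t) \<in> grids T" "T > 0"
  shows "max_step (N, t) \<ge> 0"
proof -
  have "N > 0" using assms by (auto simp: grids_def intro!: gr0I)
  then show ?thesis using grid_step_le[OF assms(1), of 0] assms(1) by (force simp: grids_def)
qed

lemma grid_cell_cases:
  assumes G: "(N, t) \<in> grids T" and "T > 0" "s \<in> {0..T}"
  obtains h where "h < N" "s \<in> {t h..t (Suc h)}"
proof (cases "s = 0")
  case True
  moreover have "N > 0" using G \<open>T > 0\<close> by (auto simp: grids_def intro!: gr0I)
  ultimately show ?thesis using that[of 0] G by (force simp: grids_def)
next
  case False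
  define k where "k = (LEAST k. s \<le> t k)"
  have "s \<le> t N" using G \<open>s \<in> {0..T}\<close> by (auto simp: grids_def)
  then have k: "s \<le> t k" "k \<le> N"
    unfolding k_def by (auto intro: LeastI Least_le)
  have "k \<noteq> 0"
  proof
    assume "k = 0"
    then show False using k G False \<open>s \<in> {0..T}\<close> by (auto simp: grids_def)
  qed
  then obtain h where h: "k = Suc h" by (cases k) auto
  then have "\<not> s \<le> t h" unfolding k_def by (metis lessI not_less_Least)
  then show ?thesis using that[of h] h k by auto
qed

lemma interp_eq_half_open:
  assumes G: "(N, t) \<in> grids T" and h: "h < N" and s: "t h < s" "s \<le> t (Suc h)"
  shows "interp (N, t) U s = U h + ((s - t h) / (t (Suc h) - t h)) *\<^sub>R (U (Suc h) - U h)"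
proof -
  have "(THE k. k \<in> {1..N} \<and> s \<in> {t (k - 1) <.. t k}) = Suc h"
  proof (rule the_equality)
    fix k assume k: "k \<in> {1..N} \<and> s \<in> {t (k - 1) <.. t k}"
    show "k = Suc h"
    proof (rule linorder_cases[of k "Suc h"])
      assume "k < Suc h"
      then show ?thesis using grid_mono[OF G, of k h] h k s by auto
    next
      assume "Suc h < k"
      then have "t (Suc h) \<le> t (k - 1)" using k by (intro grid_mono[OF G]) auto
      then show ?thesis using k s by auto
    qed
  qed (use h s in auto)
  moreover have "s \<noteq> 0" using grid_bounds[OF G, of h] h s by auto
  moreover have pos: "t (Suc h) - t h > 0" using G h by (auto simp: grids_def)
  define c where "c = (s - t h) / (t (Suc h) - t h)"
  have "(t (Suc h) - s) / (t (Suc h) - t h) = 1 - c"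
    using pos by (simp add: c_def field_simps)
  moreover have "(1 - c) *\<^sub>R U h + c *\<^sub>R U (Suc h) = U h + c *\<^sub>R (U (Suc h) - U h)"
    by (simp add: algebra_simps)
  ultimately show ?thesis using pos by (simp add: interp_def step_def Let_def c_def)
qed

text \<open>
  At an interior node the interpolant is defined by the cell to the left of the node; the formula of
  the cell to the right gives the same value there. Having the formula on closed cells yields
  continuity.
\<close>

lemma interp_eq:
  assumes G: "(N, t) \<in> grids T" and h: "h < N" and s: "s \<in> {t h..t (Suc h)}"
  shows "interp (N, t) U s = U h + ((s - t h) / (t (Suc h) - t h)) *\<^sub>R (U (Suc h) - U h)"
proof (cases "s = t h")
  case True
  show ?thesis
  proof (cases h)
    case 0
    then show ?thesis using True G by (auto simp: interp_def grids_def)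
  next
    case (Suc m)
    moreover have "t m < t (Suc m)" using G h Suc by (auto simp: grids_def)
    ultimately show ?thesis using interp_eq_half_open[OF G, of m s U] h True by simp
  qed
next
  case False
  with s have "t h < s" "s \<le> t (Suc h)" by auto
  then show ?thesis by (rule interp_eq_half_open[OF G h])
qed

lemma continuous_on_interp:
  fixes U :: "nat \<Rightarrow> 'a::real_normed_vector"
  assumes G: "(N, t) \<in> grids T"
  shows "continuous_on {0..T} (interp (N, t) U)"
proof -
  have "continuous_on {0..t k} (interp (N, t) U)" if "k \<le> N" for k
    using that
  proof (induction k)
    case 0
    then show ?case using G by (simp add: grids_def)
  next
    case (Suc k)
    have "t k < t (Suc k)" using G Suc.prems by (auto simp: grids_def)
    then have "continuous_on {t k..t (Suc k)} (\<lambda>s. U k + ((s - t k) / (t (Suc k) - t k)) *\<^sub>R (U (Suc k) - U k))"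
      by (intro continuous_intros) auto
    then have "continuous_on {t k..t (Suc k)} (interp (N, t) U)"
      using interp_eq[OF G, of k _ U] Suc.prems by (subst continuous_on_cong[OF refl]) auto
    then have "continuous_on ({0..t k} \<union> {t k..t (Suc k)}) (interp (N, t) U)"
      using Suc by (intro continuous_on_closed_Un) auto
    moreover have "{0..t k} \<union> {t k..t (Suc k)} = {0..t (Suc k)}"
      using grid_bounds[OF G, of k] grid_mono[OF G, of k "Suc k"] Suc.prems by auto
    ultimately show ?case by simp
  qed
  from this[of N] show ?thesis using G by (simp add: grids_def)
qed

lemma interp_in_convex:
  assumes G: "(N, t) \<in> grids T" and "T > 0" and "convex C" and U: "\<And>h. h \<le> N \<Longrightarrow> U h \<in> C"
    and "s \<in> {0..T}"
  shows "interp (N, t) U s \<in> C"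
proof -
  obtain h where h: "h < N" "s \<in> {t h..t (Suc h)}"
    using grid_cell_cases[OF G \<open>T > 0\<close> \<open>s \<in> {0..T}\<close>] .
  define c where "c = (s - t h) / (t (Suc h) - t h)"
  have "t (Suc h) - t h > 0" using G h by (auto simp: grids_def)
  then have c: "0 \<le> c" "c \<le> 1" using h by (auto simp: c_def)
  have "interp (N, t) U s = (1 - c) *\<^sub>R U h + c *\<^sub>R U (Suc h)"
    using interp_eq[OF G h, of U] by (simp add: c_def algebra_simps)
  then show ?thesis using convexD_alt[OF \<open>convex C\<close> _ _ c] U h by simp
qed

section \<open>Explicit Euler schemes for gradient flows\<close>

definition euler :: "('a::real_vector \<Rightarrow> 'a) \<Rightarrow> 'a \<Rightarrow> grid \<Rightarrow> (nat \<Rightarrow> 'a) \<Rightarrow> bool" where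
  "euler f g = (\<lambda>(N, t) U. U 0 = g \<and> (\<forall>h<N. U (Suc h) = U h + (t (Suc h) - t h) *\<^sub>R f (U h)))"

lemma interp_euler_eq:
  assumes G: "(N, t) \<in> grids T" and "euler f g (N, t) U" and h: "h < N" and s: "s \<in> {t h..t (Suc h)}"
  shows "interp (N, t) U s = U h + (s - t h) *\<^sub>R f (U h)"
proof -
  have "t (Suc h) - t h > 0" using G h by (auto simp: grids_def)
  moreover have "U (Suc h) - U h = (t (Suc h) - t h) *\<^sub>R f (U h)"
    using assms(2) h by (simp add: euler_def)
  ultimately show ?thesis by (simp add: interp_eq[OF G h s])
qed

lemma interp_euler_has_derivative:
  fixes f :: "'a::real_normed_vector \<Rightarrow> 'a"
  assumes G: "(N, t) \<in> grids T" and U: "euler f g (N, t) U" and "T > 0"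
    and s: "s \<in> {0<..<T} - t ` {..N}"
  obtains h where "h < N" "(interp (N, t) U has_vector_derivative f (U h)) (at s)"
    "norm (interp (N, t) U s - U h) \<le> max_step (N, t) * norm (f (U h))"
proof -
  obtain h where h: "h < N" "s \<in> {t h..t (Suc h)}"
    using grid_cell_cases[OF G \<open>T > 0\<close>, of s] s by auto
  have "t h \<in> t ` {..N}" "t (Suc h) \<in> t ` {..N}" using h by auto
  with s h have s': "s \<in> {t h<..<t (Suc h)}" by (auto simp: order_less_le)
  have "((\<lambda>s. U h + (s - t h) *\<^sub>R f (U h)) has_vector_derivative f (U h)) (at s)"
    by (auto intro!: derivative_eq_intros)
  then have "(interp (N, t) U has_vector_derivative f (U h)) (at s)"
    by (rule has_vector_derivative_transform_within_open[OF _ _ s'])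
       (auto simp: interp_euler_eq[OF G U h(1)])
  moreover have "norm (interp (N, t) U s - U h) \<le> max_step (N, t) * norm (f (U h))"
    using interp_euler_eq[OF G U h] h(2) grid_step_le[OF G h(1)]
    by (auto intro!: mult_right_mono)
  ultimately show ?thesis using that h(1) by blast
qed

text \<open>
  Taking the supremum distance to a fixed point is 1-Lipschitz for uniform distance, so uniformly
  Cauchy interpolants have Cauchy suprema.
\<close>

lemma SUP_norm_diff_le:
  fixes u v :: "'b::topological_space \<Rightarrow> 'a::real_normed_vector"
  assumes "compact S" "S \<noteq> {}" "continuous_on S u" "continuous_on S v"
    and "\<And>s. s \<in> S \<Longrightarrow> norm (u s - v s) \<le> e"
  shows "(SUP s\<in>S. norm (u s - g)) \<le> (SUP s\<in>S. norm (v s - g)) + e"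
proof (rule cSUP_least[OF \<open>S \<noteq> {}\<close>])
  fix s assume s: "s \<in> S"
  have "bdd_above ((\<lambda>s. norm (v s - g)) ` S)"
    using assms by (intro bounded_imp_bdd_above compact_imp_bounded compact_continuous_image continuous_intros)
  then have "norm (v s - g) \<le> (SUP s\<in>S. norm (v s - g))"
    using s by (rule cSUP_upper2) auto
  moreover have "norm (u s - g) \<le> norm (u s - v s) + norm (v s - g)"
    using norm_triangle_ineq[of "u s - v s" "v s - g"] by simp
  ultimately show "norm (u s - g) \<le> (SUP s\<in>S. norm (v s - g)) + e"
    using assms(5)[OF s] by linarith
qed

text \<open>
  The subgradient inequality says that \<open>- f u\<close> is a subgradient of \<open>E\<close> at \<open>u\<close>, so that
  \<open>u' = f u\<close> is the gradient flow of the convex function \<open>E\<close>. Boundedness of \<open>f\<close> on balls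
  controls how far a single Euler step moves.
\<close>

locale gradient_flow =
  fixes f :: "'a::real_inner \<Rightarrow> 'a" and E :: "'a \<Rightarrow> real"
  assumes subgradient: "f u \<bullet> (u - v) \<le> E v - E u"
    and E_nonneg: "E u \<ge> 0"
    and bounded_on_balls: "bounded (f ` cball u r)"
begin

lemma dissipative: "(f u - f v) \<bullet> (u - v) \<le> 0"
  using subgradient[of u v] subgradient[of v u] by (simp add: inner_simps)

text \<open>
  Expanding \<open>\<bar>u + d f u - g\<bar>\<^sup>2\<close> and using the subgradient inequality for the mixed term, a step
  of length \<open>d\<close> adds at most \<open>2 d E g + d \<tau> M\<^sup>2\<close>. The bound \<open>M\<close> on \<open>f\<close> is available
  only inside the ball of radius \<open>R\<close>, so that the iterates stay in this ball is part of the same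
  induction; the smallness of \<open>\<tau> M\<^sup>2 T\<close> keeps the accumulated error within the margin of 1
  that \<open>R\<^sup>2\<close> leaves above \<open>2 T E g\<close>.
\<close>

lemma euler_dist:
  assumes G: "(N, t) \<in> grids T" and U: "euler f g (N, t) U" and "T > 0"
    and R: "2 * T * E g + 1 \<le> R\<^sup>2" "R \<ge> 0"
    and M: "\<And>u. u \<in> cball g R \<Longrightarrow> norm (f u) \<le> M"
    and fine: "max_step (N, t) * M\<^sup>2 * T \<le> 1"
    and "h \<le> N"
  shows "U h \<in> cball g R" "(norm (U h - g))\<^sup>2 \<le> T * (2 * E g + max_step (N, t) * M\<^sup>2)"
proof -
  let ?\<tau> = "max_step (N, t)"
  have \<tau>: "?\<tau> \<ge> 0" using max_step_nonneg[OF G \<open>T > 0\<close>] .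
  have nn: "2 * E g + ?\<tau> * M\<^sup>2 \<ge> 0" using \<tau> E_nonneg[of g] by simp
  have le_T: "t h * (2 * E g + ?\<tau> * M\<^sup>2) \<le> T * (2 * E g + ?\<tau> * M\<^sup>2)" if "h \<le> N" for h
    using grid_bounds[OF G that] nn by (intro mult_right_mono) auto
  have ball: "u \<in> cball g R" if "(norm (u - g))\<^sup>2 \<le> T * (2 * E g + ?\<tau> * M\<^sup>2)" for u
  proof -
    have "T * (2 * E g + ?\<tau> * M\<^sup>2) = 2 * T * E g + ?\<tau> * M\<^sup>2 * T" by (simp add: algebra_simps)
    then have "(norm (u - g))\<^sup>2 \<le> R\<^sup>2" using that R(1) fine by linarith
    then have "norm (u - g) \<le> R" using R(2) by (rule power2_le_imp_le)
    then show ?thesis by (simp add: dist_norm norm_minus_commute)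
  qed
  have main: "(norm (U h - g))\<^sup>2 \<le> t h * (2 * E g + ?\<tau> * M\<^sup>2)" if "h \<le> N" for h
    using that
  proof (induction h)
    case 0
    then show ?case using U G by (simp add: euler_def grids_def)
  next
    case (Suc h)
    define d where "d = t (Suc h) - t h"
    have d: "0 \<le> d" "d \<le> ?\<tau>"
      using grid_step_le[OF G, of h] Suc.prems grid_mono[OF G, of h "Suc h"] by (auto simp: d_def)
    have IH: "(norm (U h - g))\<^sup>2 \<le> t h * (2 * E g + ?\<tau> * M\<^sup>2)" using Suc by simp
    then have "norm (f (U h)) \<le> M" using le_T[of h] Suc.prems by (intro M ball) auto
    then have "d\<^sup>2 * (norm (f (U h)))\<^sup>2 \<le> d * ?\<tau> * M\<^sup>2"
      using d by (simp add: power2_eq_square[of d] mult_mono power_mono)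
    moreover have "2 * d * (f (U h) \<bullet> (U h - g)) \<le> 2 * d * E g"
      using subgradient[of "U h" g] E_nonneg[of "U h"] d by (intro mult_left_mono) auto
    moreover have "U (Suc h) - g = (U h - g) + d *\<^sub>R f (U h)"
      using U Suc.prems by (simp add: euler_def d_def)
    then have "(norm (U (Suc h) - g))\<^sup>2
       = (norm (U h - g))\<^sup>2 + 2 * d * (f (U h) \<bullet> (U h - g)) + d\<^sup>2 * (norm (f (U h)))\<^sup>2"
      by (simp only: power2_norm_eq_inner) (simp add: inner_add_left inner_add_right inner_commute power2_eq_square)
    ultimately have "(norm (U (Suc h) - g))\<^sup>2 \<le> t h * (2 * E g + ?\<tau> * M\<^sup>2) + 2 * d * E g + d * ?\<tau> * M\<^sup>2"
      using IH by linarith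
    also have "\<dots> = t (Suc h) * (2 * E g + ?\<tau> * M\<^sup>2)"
      by (simp add: d_def algebra_simps)
    finally show ?case .
  qed
  show "(norm (U h - g))\<^sup>2 \<le> T * (2 * E g + ?\<tau> * M\<^sup>2)"
    using main le_T \<open>h \<le> N\<close> by (meson order_trans)
  then show "U h \<in> cball g R" by (rule ball)
qed

text \<open>
  Away from the nodes the interpolants move with velocities \<open>f (U h)\<close> and \<open>f (U' k)\<close>, where
  \<open>U h\<close> and \<open>U' k\<close> are within \<open>\<tau> M\<close> and \<open>\<tau>' M\<close> of the current positions. In the
  derivative \<open>2 (f (U h) - f (U' k)) \<bullet> (u - v)\<close> of \<open>\<bar>u - v\<bar>\<^sup>2\<close>, dissipativity
  disposes of the part with \<open>U h - U' k\<close> in place of \<open>u - v\<close>, and the rest is at most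
  \<open>2 * 2 M * (\<tau> M + \<tau>' M)\<close>. Integration over the complement of the finitely many nodes gives
  the bound.
\<close>

lemma interp_euler_diff:
  assumes G: "(N, t) \<in> grids T" and U: "euler f g (N, t) U"
    and G': "(N', t') \<in> grids T" and U': "euler f g (N', t') U'" and "T > 0"
    and M: "\<And>h. h \<le> N \<Longrightarrow> norm (f (U h)) \<le> M"
    and M': "\<And>h. h \<le> N' \<Longrightarrow> norm (f (U' h)) \<le> M"
    and s: "s \<in> {0..T}"
  shows "(norm (interp (N, t) U s - interp (N', t') U' s))\<^sup>2
     \<le> 4 * M\<^sup>2 * (max_step (N, t) + max_step (N', t')) * T"
proof -
  let ?u = "interp (N, t) U" and ?v = "interp (N', t') U'"
  let ?\<tau> = "max_step (N, t)" and ?\<tau>' = "max_step (N', t')"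
  define C where "C = 4 * M\<^sup>2 * (?\<tau> + ?\<tau>')"
  have \<tau>: "?\<tau> \<ge> 0" "?\<tau>' \<ge> 0"
    using max_step_nonneg G G' \<open>T > 0\<close> by blast+
  have "C \<ge> 0" using \<tau> by (simp add: C_def)
  have "M \<ge> 0" using M[of 0] norm_ge_zero order_trans by blast
  define w where "w r = (norm (?u r - ?v r))\<^sup>2" for r
  define S where "S = t ` {..N} \<union> t' ` {..N'}"
  have "\<exists>D. (w has_vector_derivative D) (at r) \<and> D \<le> C" if r: "r \<in> {0<..<T} - S" for r
  proof -
    have rt: "r \<in> {0<..<T} - t ` {..N}" and rt': "r \<in> {0<..<T} - t' ` {..N'}"
      using r by (auto simp: S_def)
    obtain h where h: "h < N" "(?u has_vector_derivative f (U h)) (at r)"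
      and hu: "norm (?u r - U h) \<le> ?\<tau> * norm (f (U h))"
      using interp_euler_has_derivative[OF G U \<open>T > 0\<close> rt] .
    obtain k where k: "k < N'" "(?v has_vector_derivative f (U' k)) (at r)"
      and kv: "norm (?v r - U' k) \<le> ?\<tau>' * norm (f (U' k))"
      using interp_euler_has_derivative[OF G' U' \<open>T > 0\<close> rt'] .
    let ?d = "f (U h) - f (U' k)"
    have "((\<lambda>r. ?u r - ?v r) has_vector_derivative ?d) (at r)"
      using h(2) k(2) by (rule has_vector_derivative_diff)
    then have "(w has_vector_derivative ((?u r - ?v r) \<bullet> ?d + ?d \<bullet> (?u r - ?v r))) (at r)"
      unfolding w_def power2_norm_eq_inner
      by (intro bounded_bilinear.has_vector_derivative[OF bounded_bilinear_inner])
    moreover have "?d \<bullet> (?u r - ?v r) \<le> C / 2"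
    proof -
      have "norm ?d \<le> 2 * M"
        using M[of h] M'[of k] h(1) k(1) norm_triangle_ineq4[of "f (U h)" "f (U' k)"] by auto
      moreover have "norm ((?u r - U h) - (?v r - U' k)) \<le> ?\<tau> * M + ?\<tau>' * M"
      proof -
        have "?\<tau> * norm (f (U h)) \<le> ?\<tau> * M" "?\<tau>' * norm (f (U' k)) \<le> ?\<tau>' * M"
          using M[of h] M'[of k] h(1) k(1) \<tau> by (auto intro: mult_left_mono)
        then show ?thesis
          using hu kv norm_triangle_ineq4[of "?u r - U h" "?v r - U' k"] by linarith
      qed
      ultimately have "?d \<bullet> ((?u r - U h) - (?v r - U' k)) \<le> (2 * M) * (?\<tau> * M + ?\<tau>' * M)"
        using \<open>M \<ge> 0\<close> by (intro order_trans[OF norm_cauchy_schwarz] mult_mono) auto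
      moreover have "?d \<bullet> (?u r - ?v r) = ?d \<bullet> (U h - U' k) + ?d \<bullet> ((?u r - U h) - (?v r - U' k))"
        by (simp only: inner_add_right[symmetric]) (simp add: algebra_simps)
      ultimately show ?thesis
        using dissipative[of "U h" "U' k"] by (simp add: C_def power2_eq_square algebra_simps)
    qed
    ultimately show ?thesis
      by (intro exI conjI) (auto simp: inner_commute mult_ac)
  qed
  then obtain w' where w': "\<And>r. r \<in> {0<..<T} - S \<Longrightarrow> (w has_vector_derivative w' r) (at r) \<and> w' r \<le> C"
    by metis
  have "((\<lambda>r. if r \<in> {0<..<T} - S then w' r else 0) has_integral (w s - w 0)) {0..s}"
  proof (rule fundamental_theorem_of_calculus_interior_strong[where S = S])
    show "continuous_on {0..s} w"
      unfolding w_def using s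
      by (intro continuous_intros continuous_on_subset[OF continuous_on_interp[OF G]]
            continuous_on_subset[OF continuous_on_interp[OF G']]) auto
  qed (use s w' in \<open>auto simp: S_def\<close>)
  moreover have "((\<lambda>r. C) has_integral C * s) {0..s}"
    using has_integral_const_real[of C 0 s] s by (simp add: mult.commute)
  ultimately have "w s - w 0 \<le> C * s"
    by (rule has_integral_le) (use w' \<open>C \<ge> 0\<close> in auto)
  also have "C * s \<le> C * T"
    using s \<open>C \<ge> 0\<close> by (intro mult_left_mono) auto
  finally show ?thesis
    using U U' by (simp add: w_def C_def interp_def euler_def)
qed

text \<open>
  Only the distance of the interpolants to \<open>g\<close> is followed to the limit: \<open>interp_euler_diff\<close> makes it
  a Cauchy net of real numbers, and \<open>euler_dist\<close> bounds it by \<open>sqrt (2 T E g + \<eta>)\<close>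
  on grids that are fine depending on \<open>\<eta>\<close>.
\<close>

lemma euler_limit:
  assumes "T > 0" and U: "\<And>G. G \<in> grids T \<Longrightarrow> euler f g G (U G)"
  obtains L where "0 \<le> L" "L \<le> sqrt (2 * T * E g)"
    "((\<lambda>G. SUP s\<in>{0..T}. norm (interp G (U G) s - g)) \<longlongrightarrow> L) (refining T)"
proof -
  define R where "R = sqrt (2 * T * E g + 1)"
  have R: "2 * T * E g + 1 \<le> R\<^sup>2" "R \<ge> 0"
    using \<open>T > 0\<close> E_nonneg[of g] by (auto simp: R_def)
  obtain M where "M > 0" and M: "\<And>u. u \<in> cball g R \<Longrightarrow> norm (f u) \<le> M"
    using bounded_on_balls[of g R] unfolding bounded_pos by auto
  define F where "F G = (SUP s\<in>{0..T}. norm (interp G (U G) s - g))" for G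
  \<comment> \<open>Below \<open>\<delta>\<^sub>0\<close> grids are fine enough for the stability bound \<open>euler_dist\<close>.\<close>
  define \<delta>\<^sub>0 where "\<delta>\<^sub>0 = 1 / (M\<^sup>2 * T)"
  have "\<delta>\<^sub>0 > 0" using \<open>M > 0\<close> \<open>T > 0\<close> by (simp add: \<delta>\<^sub>0_def)
  have fine: "max_step G * M\<^sup>2 * T \<le> 1" if "max_step G < \<delta>\<^sub>0" for G
    using that \<open>M > 0\<close> \<open>T > 0\<close> by (simp add: \<delta>\<^sub>0_def field_simps)
  note dist = euler_dist[OF _ U \<open>T > 0\<close> R M fine]
  have F_diff: "F G \<le> F G' + e"
    if e: "e > 0" and G: "G \<in> grids T" "max_step G < \<delta>\<^sub>0" "max_step G < e\<^sup>2 / (8 * M\<^sup>2 * T)"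
      and G': "G' \<in> grids T" "max_step G' < \<delta>\<^sub>0" "max_step G' < e\<^sup>2 / (8 * M\<^sup>2 * T)" for e G G'
  proof -
    obtain N t N' t' where [simp]: "G = (N, t)" "G' = (N', t')" by (cases G; cases G')
    have "norm (interp G (U G) s - interp G' (U G') s) \<le> e" if s: "s \<in> {0..T}" for s
    proof (rule power2_le_imp_le)
      have "(norm (interp G (U G) s - interp G' (U G') s))\<^sup>2 \<le> 4 * M\<^sup>2 * (max_step G + max_step G') * T"
        using G G' s unfolding \<open>G = _\<close> \<open>G' = _\<close>
        by (intro interp_euler_diff[where g = g] U \<open>T > 0\<close> M dist(1)) auto
      also have "\<dots> \<le> e\<^sup>2"
        using G(3) G'(3) \<open>M > 0\<close> \<open>T > 0\<close> by (simp add: field_simps)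
      finally show "(norm (interp G (U G) s - interp G' (U G') s))\<^sup>2 \<le> e\<^sup>2" .
    qed (use e in simp)
    then show ?thesis
      unfolding F_def using G G' \<open>T > 0\<close>
      by (intro SUP_norm_diff_le) (auto intro: continuous_on_interp)
  qed
  have "cauchy_filter (filtermap F (refining T))"
    unfolding cauchy_filter_metric_filtermap
  proof (intro allI impI)
    fix e :: real assume "e > 0"
    let ?\<delta> = "min \<delta>\<^sub>0 ((e / 2)\<^sup>2 / (8 * M\<^sup>2 * T))"
    have "?\<delta> > 0" using \<open>e > 0\<close> \<open>\<delta>\<^sub>0 > 0\<close> \<open>M > 0\<close> \<open>T > 0\<close> by simp
    from eventually_refining[OF this, of T]
    show "\<exists>P. eventually P (refining T) \<and> (\<forall>G G'. P G \<and> P G' \<longrightarrow> dist (F G) (F G') < e)"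
    proof (intro exI conjI allI impI)
      fix G G' assume "(G \<in> grids T \<and> max_step G < ?\<delta>) \<and> (G' \<in> grids T \<and> max_step G' < ?\<delta>)"
      then have "F G \<le> F G' + e / 2" "F G' \<le> F G + e / 2"
        using \<open>e > 0\<close> by (auto intro!: F_diff)
      then show "dist (F G) (F G') < e" using \<open>e > 0\<close> by (simp add: dist_real_def)
    qed
  qed
  then obtain L where "filtermap F (refining T) \<le> nhds L"
    using cauchy_filter_complete_converges[OF _ complete_UNIV, of "filtermap F (refining T)"]
      refining_neq_bot[OF \<open>T > 0\<close>] by (auto simp: filtermap_bot_iff)
  then have L: "(F \<longlongrightarrow> L) (refining T)" by (simp add: filterlim_def)
  have bounds: "0 \<le> F G \<and> F G \<le> sqrt (2 * T * E g + \<eta>)"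
    if "\<eta> > 0" and G: "G \<in> grids T" "max_step G < \<delta>\<^sub>0" "max_step G < \<eta> / (M\<^sup>2 * T)" for G \<eta>
  proof -
    obtain N t where [simp]: "G = (N, t)" by (cases G)
    let ?r = "sqrt (2 * T * E g + \<eta>)"
    have "U G h \<in> cball g ?r" if "h \<le> N" for h
    proof -
      have "max_step G * (M\<^sup>2 * T) \<le> \<eta>"
        using G(3) \<open>M > 0\<close> \<open>T > 0\<close> by (simp add: field_simps)
      then have "(norm (U G h - g))\<^sup>2 \<le> 2 * T * E g + \<eta>"
        using dist(2)[of N t h] G that by (simp add: algebra_simps)
      then show ?thesis
        using real_le_rsqrt by (simp add: dist_norm norm_minus_commute)
    qed
    then have "interp G (U G) s \<in> cball g ?r" if "s \<in> {0..T}" for s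
      using interp_in_convex[of N t T "cball g ?r" "U G" s] G(1) \<open>T > 0\<close> that by simp
    then have le: "norm (interp G (U G) s - g) \<le> ?r" if "s \<in> {0..T}" for s
      using that by (simp add: dist_norm norm_minus_commute)
    have "norm (interp G (U G) 0 - g) \<le> F G"
      unfolding F_def using le \<open>T > 0\<close> by (intro cSUP_upper bdd_aboveI2[where M = ?r]) auto
    moreover have "F G \<le> ?r"
      unfolding F_def using le \<open>T > 0\<close> by (intro cSUP_least) auto
    ultimately show ?thesis using norm_ge_zero[of "interp G (U G) 0 - g"] by linarith
  qed
  have lim_bounds: "0 \<le> L \<and> L \<le> sqrt (2 * T * E g + \<eta>)" if "\<eta> > 0" for \<eta>
  proof -
    have "min \<delta>\<^sub>0 (\<eta> / (M\<^sup>2 * T)) > 0"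
      using that \<open>\<delta>\<^sub>0 > 0\<close> \<open>M > 0\<close> \<open>T > 0\<close> by simp
    from eventually_refining[OF this, of T]
    have ev: "eventually (\<lambda>G. 0 \<le> F G \<and> F G \<le> sqrt (2 * T * E g + \<eta>)) (refining T)"
      by eventually_elim (use bounds[OF that] in auto)
    show ?thesis
    proof
      show "0 \<le> L"
        using ev by (intro tendsto_lowerbound[OF L _ refining_neq_bot[OF \<open>T > 0\<close>]]) (auto elim: eventually_mono)
      show "L \<le> sqrt (2 * T * E g + \<eta>)"
        using ev by (intro tendsto_upperbound[OF L _ refining_neq_bot[OF \<open>T > 0\<close>]]) (auto elim: eventually_mono)
    qed
  qed
  then have "0 \<le> L" using zero_less_one by blast
  have "L\<^sup>2 \<le> 2 * T * E g"
  proof (rule field_le_epsilon)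
    fix \<eta> :: real assume "\<eta> > 0"
    with lim_bounds have "L \<le> sqrt (2 * T * E g + \<eta>)" by blast
    then have "L\<^sup>2 \<le> (sqrt (2 * T * E g + \<eta>))\<^sup>2" using \<open>0 \<le> L\<close> by (intro power_mono)
    then show "L\<^sup>2 \<le> 2 * T * E g + \<eta>" using \<open>\<eta> > 0\<close> \<open>T > 0\<close> E_nonneg[of g] by simp
  qed
  then have "L \<le> sqrt (2 * T * E g)" by (rule real_le_rsqrt)
  with that[OF \<open>0 \<le> L\<close>] L show ?thesis by (simp add: F_def[abs_def])
qed

end

section \<open>The discrete p-Laplacian\<close>

definition flux :: "real \<Rightarrow> real \<Rightarrow> real" where
  "flux p x = \<bar>x\<bar> powr (p - 2) * x"

lemma abs_flux: "\<bar>flux p x\<bar> = \<bar>x\<bar> powr (p - 1)"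
proof (cases "x = 0")
  case False
  have "\<bar>x\<bar> powr (p - 1) = \<bar>x\<bar> powr ((p - 2) + 1)" by simp
  also have "\<dots> = \<bar>x\<bar> powr (p - 2) * \<bar>x\<bar>"
    using False by (simp only: powr_add) simp
  finally show ?thesis by (simp add: flux_def abs_mult)
qed (simp add: flux_def)

lemma flux_mult_self: "flux p x * x = \<bar>x\<bar> powr p"
proof (cases "x = 0")
  case False
  have "\<bar>x\<bar> powr p = \<bar>x\<bar> powr ((p - 2) + 2)" by simp
  also have "\<dots> = \<bar>x\<bar> powr (p - 2) * \<bar>x\<bar>\<^sup>2"
    using False by (simp only: powr_add) simp
  finally show ?thesis by (simp add: flux_def power2_eq_square)
qed (simp add: flux_def)

lemma flux_minus: "flux p (- x) = - flux p x"
  by (simp add: flux_def)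

text \<open>
  \<open>flux p\<close> is the derivative of the convex function \<open>x \<mapsto> \<bar>x\<bar>\<^sup>p / p\<close>, and this is its
  tangent inequality. It is Young's inequality for \<open>\<bar>b\<bar> * \<bar>a\<bar>\<^sup>p\<^sup>-\<^sup>1\<close> with the conjugate
  exponents \<open>p\<close> and \<open>p / (p - 1)\<close>.
\<close>

lemma flux_subgradient:
  assumes "p > 1"
  shows "flux p a * (b - a) \<le> (\<bar>b\<bar> powr p - \<bar>a\<bar> powr p) / p"
proof -
  define q where "q = p / (p - 1)"
  have q: "q > 1" "1 / p + 1 / q = 1" and pq: "(p - 1) * q = p"
    using assms by (auto simp: q_def field_simps)
  have "flux p a * b \<le> \<bar>b\<bar> * \<bar>a\<bar> powr (p - 1)"
    by (metis abs_flux abs_ge_self abs_mult mult.commute)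
  also have "\<dots> \<le> \<bar>b\<bar> powr p / p + (\<bar>a\<bar> powr (p - 1)) powr q / q"
    using assms q by (intro Youngs_inequality) auto
  also have "(\<bar>a\<bar> powr (p - 1)) powr q / q = \<bar>a\<bar> powr p * (1 - 1 / p)"
    using q(2) by (simp add: powr_powr pq) (metis add_diff_cancel_left' divide_inverse inverse_eq_divide)
  finally show ?thesis
    by (simp add: algebra_simps diff_divide_distrib flux_mult_self[symmetric])
qed

definition p_laplacian :: "('n::finite \<Rightarrow> 'n \<Rightarrow> real) \<Rightarrow> real \<Rightarrow> real ^ 'n \<Rightarrow> real ^ 'n" where
  "p_laplacian A p u = (\<chi> i. 1 / real CARD('n) * (\<Sum>j\<in>UNIV. A i j * flux p (u $ j - u $ i)))"

text \<open>
  The factor 1/2 compensates for the double sum meeting every unordered pair twice, so that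
  \<open>p_laplacian A p\<close> is minus the gradient of \<open>p_energy A p\<close> for symmetric \<open>A\<close>.
\<close>

definition p_energy :: "('n::finite \<Rightarrow> 'n \<Rightarrow> real) \<Rightarrow> real \<Rightarrow> real ^ 'n \<Rightarrow> real" where
  "p_energy A p u =
     1 / (2 * real CARD('n)) * (\<Sum>i\<in>UNIV. \<Sum>j\<in>UNIV. A i j * (\<bar>u $ j - u $ i\<bar> powr p / p))"

text \<open>
  Summation by parts: since \<open>flux p\<close> is odd and \<open>A\<close> symmetric, exchanging \<open>i\<close> and \<open>j\<close> changes
  the sign of the coefficient of \<open>w $ i\<close>.
\<close>

lemma p_laplacian_inner:
  fixes A :: "'n::finite \<Rightarrow> 'n \<Rightarrow> real"
  assumes sym: "\<And>i j. A i j = A j i"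
  shows "p_laplacian A p u \<bullet> w =
    1 / (2 * real CARD('n)) *
      (\<Sum>i\<in>UNIV. \<Sum>j\<in>UNIV. A i j * (flux p (u $ j - u $ i) * (w $ i - w $ j)))"
proof -
  let ?S = "\<Sum>i\<in>UNIV. \<Sum>j\<in>UNIV. A i j * flux p (u $ j - u $ i) * w $ i"
  have "p_laplacian A p u \<bullet> w = 1 / real CARD('n) * ?S"
    by (simp add: p_laplacian_def inner_vec_def sum_distrib_left sum_distrib_right mult.assoc)
  moreover have "A j i * flux p (u $ i - u $ j) * w $ j = - (A i j * flux p (u $ j - u $ i) * w $ j)" for i j
    using sym[of i j] flux_minus[of p "u $ j - u $ i"] by simp
  then have "?S = - (\<Sum>i\<in>UNIV. \<Sum>j\<in>UNIV. A i j * flux p (u $ j - u $ i) * w $ j)"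
    by (subst sum.swap) (simp add: sum_negf)
  then have "2 * ?S = (\<Sum>i\<in>UNIV. \<Sum>j\<in>UNIV. A i j * (flux p (u $ j - u $ i) * (w $ i - w $ j)))"
    by (simp add: right_diff_distrib sum_subtractf mult.assoc)
  ultimately show ?thesis by (simp add: field_simps)
qed

lemma p_laplacian_subgradient:
  fixes A :: "'n::finite \<Rightarrow> 'n \<Rightarrow> real"
  assumes "p > 1" and sym: "\<And>i j. A i j = A j i" and nonneg: "\<And>i j. A i j \<ge> 0"
  shows "p_laplacian A p u \<bullet> (u - v) \<le> p_energy A p v - p_energy A p u"
proof -
  have "A i j * (flux p (u $ j - u $ i) * ((u - v) $ i - (u - v) $ j))
      \<le> A i j * (\<bar>v $ j - v $ i\<bar> powr p / p) - A i j * (\<bar>u $ j - u $ i\<bar> powr p / p)" for i j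
    using mult_left_mono[OF flux_subgradient[OF \<open>p > 1\<close>, of "u $ j - u $ i" "v $ j - v $ i"] nonneg[of i j]]
    by (simp add: algebra_simps diff_divide_distrib)
  then have "(\<Sum>i\<in>UNIV. \<Sum>j\<in>UNIV. A i j * (flux p (u $ j - u $ i) * ((u - v) $ i - (u - v) $ j)))
     \<le> (\<Sum>i\<in>UNIV. \<Sum>j\<in>UNIV. A i j * (\<bar>v $ j - v $ i\<bar> powr p / p) - A i j * (\<bar>u $ j - u $ i\<bar> powr p / p))"
    by (intro sum_mono)
  then show ?thesis
    unfolding p_laplacian_inner[OF sym] p_energy_def right_diff_distrib[symmetric] sum_subtractf[symmetric]
    by (intro mult_left_mono) auto
qed

lemma p_energy_nonneg:
  assumes "p > 1" "\<And>i j. A i j \<ge> 0"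
  shows "p_energy A p u \<ge> 0"
  unfolding p_energy_def using assms by (intro mult_nonneg_nonneg sum_nonneg divide_nonneg_nonneg) auto

text \<open>
  On \<open>S_inf A\<close> every power in the energy that carries a nonzero weight is at most 1; the weights do
  not depend on \<open>p\<close>, so only the factor \<open>1 / p\<close> remains.
\<close>

lemma p_energy_le_S_inf:
  fixes A :: "'n::finite \<Rightarrow> 'n \<Rightarrow> real"
  assumes "p > 1" and nonneg: "\<And>i j. A i j \<ge> 0" and g: "g \<in> S_inf A"
  shows "p_energy A p g \<le> (\<Sum>i\<in>UNIV. \<Sum>j\<in>UNIV. A i j) / (2 * real CARD('n)) / p"
proof -
  have "A i j * (\<bar>g $ j - g $ i\<bar> powr p / p) \<le> A i j / p" for i j
  proof (cases "A i j = 0")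
    case False
    with g have "\<bar>g $ j - g $ i\<bar> \<le> 1" by (auto simp: S_inf_def supp_def)
    then have "\<bar>g $ j - g $ i\<bar> powr p \<le> 1" using \<open>p > 1\<close> by (intro powr_le1) auto
    then show ?thesis
      using mult_left_mono[of _ 1 "A i j"] nonneg \<open>p > 1\<close> by (simp add: divide_right_mono)
  qed auto
  then have "(\<Sum>i\<in>UNIV. \<Sum>j\<in>UNIV. A i j * (\<bar>g $ j - g $ i\<bar> powr p / p)) \<le> (\<Sum>i\<in>UNIV. \<Sum>j\<in>UNIV. A i j / p)"
    by (intro sum_mono)
  from mult_left_mono[OF this, of "1 / (2 * real CARD('n))"] show ?thesis
    by (simp add: p_energy_def sum_divide_distrib[symmetric])
qed

text \<open>
  On a ball around \<open>u\<close> all differences of components are at most \<open>2 (\<bar>u\<bar> + r)\<close>, which bounds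
  the fluxes because \<open>p - 1 > 0\<close>.
\<close>

lemma bounded_p_laplacian:
  fixes A :: "'n::finite \<Rightarrow> 'n \<Rightarrow> real"
  assumes "p > 1"
  shows "bounded (p_laplacian A p ` cball u r)"
proof -
  define D where "D = 2 * (norm u + r)"
  have flux: "\<bar>flux p (v $ j - v $ i)\<bar> \<le> D powr (p - 1)" if "v \<in> cball u r" for v i j
  proof -
    have "norm v \<le> norm u + r"
      using that norm_triangle_sub[of v u] by (auto simp: dist_norm norm_minus_commute)
    then have "\<bar>v $ j - v $ i\<bar> \<le> D"
      using component_le_norm_cart[of v j] component_le_norm_cart[of v i] by (simp add: D_def)
    then show ?thesis
      using \<open>p > 1\<close> by (simp add: abs_flux powr_mono2)
  qed
  have "norm (p_laplacian A p v) \<le> (\<Sum>i\<in>UNIV. 1 / real CARD('n) * (\<Sum>j\<in>UNIV. \<bar>A i j\<bar> * D powr (p - 1)))"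
    if "v \<in> cball u r" for v
  proof -
    have "\<bar>\<Sum>j\<in>UNIV. A i j * flux p (v $ j - v $ i)\<bar> \<le> (\<Sum>j\<in>UNIV. \<bar>A i j\<bar> * D powr (p - 1))" for i
      using flux[OF that] by (intro order_trans[OF sum_abs] sum_mono) (auto simp: abs_mult intro: mult_left_mono)
    then have "\<bar>p_laplacian A p v $ i\<bar> \<le> 1 / real CARD('n) * (\<Sum>j\<in>UNIV. \<bar>A i j\<bar> * D powr (p - 1))" for i
      by (simp add: p_laplacian_def abs_mult divide_right_mono)
    then show ?thesis
      by (intro order_trans[OF norm_le_l1_cart] sum_mono)
  qed
  then show ?thesis unfolding bounded_iff by blast
qed

section \<open>Cell averages of a symmetric kernel\<close>

lemma distr_lborel_swap:
  "distr (lborel :: ('a::euclidean_space \<times> 'b::euclidean_space) measure) lborel prod.swap = lborel"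
proof -
  interpret lborel_pair: pair_sigma_finite "lborel :: 'b measure" "lborel :: 'a measure" ..
  have "distr (lborel :: ('a \<times> 'b) measure) (lborel :: ('b \<times> 'a) measure) (\<lambda>(x, y). (y, x)) = lborel"
    using lborel_pair.distr_pair_swap[symmetric] by (simp only: lborel_prod)
  then show ?thesis by (simp add: case_prod_unfold prod.swap_def[abs_def])
qed

lemma measurable_lebesgue_lborel_swap:
  "prod.swap \<in> (lebesgue :: ('a::euclidean_space \<times> 'b::euclidean_space) measure) \<rightarrow>\<^sub>M lborel"
  by (intro measurable_completion) (simp add: borel_measurable_continuous_onI continuous_on_swap)

lemma distr_lebesgue_lborel_swap:
  "distr (lebesgue :: ('a::euclidean_space \<times> 'b::euclidean_space) measure) lborel prod.swap = lborel"
  by (simp add: distr_completion distr_lborel_swap borel_measurable_continuous_onI continuous_on_swap)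

lemma measurable_lebesgue_swap:
  "prod.swap \<in> (lebesgue :: ('a::euclidean_space \<times> 'b::euclidean_space) measure) \<rightarrow>\<^sub>M lebesgue"
  by (rule completion.measurable_completion2[OF measurable_lebesgue_lborel_swap])
     (simp add: distr_lebesgue_lborel_swap)

text \<open>
  The corresponding fact for \<open>lborel\<close> is symmetry of the product measure. It is carried over to the
  completion because \<open>cell_avg\<close> integrates with respect to \<open>lebesgue\<close>, for a kernel that is only
  Lebesgue measurable.
\<close>

lemma distr_lebesgue_swap:
  "distr (lebesgue :: ('a::euclidean_space \<times> 'b::euclidean_space) measure) lebesgue prod.swap = lebesgue"
  using completion.completion_distr_eq[OF measurable_lebesgue_lborel_swap[where 'a = 'a and 'b = 'b]]
  by (simp add: distr_lebesgue_lborel_swap)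

lemma cell_subset_unit_interval:
  assumes "i \<in> {1..n}"
  shows "cell n i \<subseteq> {0..1}"
proof -
  have "0 \<le> (real i - 1) / real n" "real i / real n \<le> 1"
    using assms by auto
  then show ?thesis by (auto simp: cell_def)
qed

lemma cell_times_sets: "cell n i \<times> cell n j \<in> sets lebesgue"
proof -
  have "cell n i \<times> cell n j \<in> sets borel"
    unfolding cell_def by (intro borel_Times) auto
  then show ?thesis by simp
qed

lemma cell_avg_commute:
  assumes "i \<in> {1..n}" "j \<in> {1..n}"
    and sym: "\<And>x y. x \<in> {0..1} \<Longrightarrow> y \<in> {0..1} \<Longrightarrow> K x y = K y x"
    and meas: "(\<lambda>(x, y). K x y) \<in> borel_measurable (lebesgue_on ({0..1} \<times> {0..1}))"
  shows "cell_avg K n i j = cell_avg K n j i"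
proof -
  let ?F = "\<lambda>i j z. indicator (cell n i \<times> cell n j) z *\<^sub>R (case z of (x, y) \<Rightarrow> K x y)"
  have sets_lebesgue_unit_square: "{0..1} \<times> {0..1} \<in> sets (lebesgue :: (real \<times> real) measure)"
    using borel_Times[of "{0..1::real}" "{0..1::real}"] by simp
  have sub: "cell n i \<times> cell n j \<subseteq> {0..1} \<times> {0..1}"
    using cell_subset_unit_interval assms(1,2) by blast
  have "(\<lambda>z. if z \<in> {0..1} \<times> {0..1} then (case z of (x, y) \<Rightarrow> K x y) else 0) \<in> borel_measurable lebesgue"
    by (subst borel_measurable_if[OF sets_lebesgue_unit_square]) (rule meas)
  then have "(\<lambda>z. indicator (cell n i \<times> cell n j) z *\<^sub>R
      (if z \<in> {0..1} \<times> {0..1} then (case z of (x, y) \<Rightarrow> K x y) else 0)) \<in> borel_measurable lebesgue"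
    by (rule borel_measurable_scaleR[OF borel_measurable_indicator[OF cell_times_sets]])
  also have "(\<lambda>z. indicator (cell n i \<times> cell n j) z *\<^sub>R
      (if z \<in> {0..1} \<times> {0..1} then (case z of (x, y) \<Rightarrow> K x y) else 0)) = ?F i j"
  proof
    fix z show "indicator (cell n i \<times> cell n j) z *\<^sub>R
      (if z \<in> {0..1} \<times> {0..1} then (case z of (x, y) \<Rightarrow> K x y) else 0) = ?F i j z"
      using sub by (cases "z \<in> cell n i \<times> cell n j") auto
  qed
  finally have F: "?F i j \<in> borel_measurable lebesgue" .
  have "integral\<^sup>L lebesgue (?F i j) = integral\<^sup>L (distr lebesgue lebesgue prod.swap) (?F i j)"
    by (simp only: distr_lebesgue_swap)
  also have "\<dots> = integral\<^sup>L lebesgue (\<lambda>z. ?F i j (prod.swap z))"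
    by (rule integral_distr[OF measurable_lebesgue_swap F])
  also have "(\<lambda>z. ?F i j (prod.swap z)) = ?F j i"
  proof
    fix z :: "real \<times> real"
    obtain x y where z: "z = (x, y)" by force
    show "?F i j (prod.swap z) = ?F j i z"
    proof (cases "x \<in> cell n j \<and> y \<in> cell n i")
      case True
      with sub have "x \<in> {0..1}" "y \<in> {0..1}" by blast+
      with True show ?thesis using sym by (simp add: z)
    qed (auto simp: z)
  qed
  finally show ?thesis by (simp add: cell_avg_def set_lebesgue_integral_def)
qed

lemma cell_avg_nonneg:
  assumes "i \<in> {1..n}" "j \<in> {1..n}"
    and "\<And>x y. x \<in> {0..1} \<Longrightarrow> y \<in> {0..1} \<Longrightarrow> K x y \<ge> 0"
  shows "cell_avg K n i j \<ge> 0"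
proof -
  have "indicator (cell n i \<times> cell n j) z *\<^sub>R (case z of (x, y) \<Rightarrow> K x y) \<ge> 0" for z
  proof (cases "z \<in> cell n i \<times> cell n j")
    case True
    then have "fst z \<in> {0..1}" "snd z \<in> {0..1}"
      using subsetD[OF cell_subset_unit_interval] assms(1,2) unfolding mem_Times_iff by blast+
    then show ?thesis using assms(3)[of "fst z" "snd z"] by (simp add: case_prod_unfold)
  next
    case False
    then show ?thesis by simp
  qed
  then show ?thesis
    unfolding cell_avg_def set_lebesgue_integral_def
    by (intro mult_nonneg_nonneg Bochner_Integration.integral_nonneg) simp_all
qed

section \<open>Convergence\<close>

text \<open>
  \<open>p_laplacian A p\<close> is the right-hand side of the scheme; multiplying by the positive step turns the
  difference quotient into an Euler step.
\<close>

lemma solves_scheme_imp_euler: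
  assumes G: "G \<in> grids T" and "solves_scheme A g p G U"
  shows "euler (p_laplacian A p) g G U"
proof -
  obtain N t where [simp]: "G = (N, t)" by (cases G)
  have "U (Suc h) = U h + (t (Suc h) - t h) *\<^sub>R p_laplacian A p (U h)" if "h < N" for h
  proof (subst vec_eq_iff, intro allI)
    fix i
    have pos: "t (Suc h) - t h > 0" using G that by (auto simp: grids_def)
    have "Suc h \<in> {1..N}" using that by auto
    then have "(U (Suc h) $ i - U h $ i) / step t h = p_laplacian A p (U h) $ i"
      using assms(2) unfolding solves_scheme_def p_laplacian_def flux_def
      by (force simp: mult.assoc)
    then show "U (Suc h) $ i = (U h + (t (Suc h) - t h) *\<^sub>R p_laplacian A p (U h)) $ i"
      using pos by (simp add: step_def divide_eq_eq algebra_simps)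
  qed
  moreover have "U 0 = g" using assms(2) by (simp add: solves_scheme_def)
  ultimately show ?thesis by (simp add: euler_def)
qed

theorem theorem6p6:
  fixes T :: real
    and idx :: "'n::finite \<Rightarrow> nat"
    and K :: "real \<Rightarrow> real \<Rightarrow> real"
    and g :: "real ^ 'n"
    and U :: "real \<Rightarrow> grid \<Rightarrow> nat \<Rightarrow> real ^ 'n"
    and Uinf :: "real \<Rightarrow> real ^ 'n"
  assumes T: "T > 0"
    and idx: "bij_betw idx UNIV {1..CARD('n)}"
    and K_sym: "\<And>x y. x \<in> {0..1} \<Longrightarrow> y \<in> {0..1} \<Longrightarrow> K x y = K y x"
    and K_nonneg: "\<And>x y. x \<in> {0..1} \<Longrightarrow> y \<in> {0..1} \<Longrightarrow> K x y \<ge> 0"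
    and K_bounded: "bounded ((\<lambda>(x, y). K x y) ` ({0..1} \<times> {0..1}))"
    and K_measurable: "(\<lambda>(x, y). K x y) \<in> borel_measurable (lebesgue_on ({0..1} \<times> {0..1}))"
    and supp_nonempty: "supp (K_hat idx K) \<noteq> {}"
    and g: "g \<in> S_inf (K_hat idx K)"
    and U: "\<And>p G. p > 1 \<Longrightarrow> G \<in> grids T \<Longrightarrow> solves_scheme (K_hat idx K) g p G (U p G)"
    and Uinf: "strong_solution (normal_cone (S_inf (K_hat idx K))) g T Uinf"
  shows "\<exists>L :: real \<Rightarrow> real.
    (\<forall>p>1. ((\<lambda>G. SUP t\<in>{0..T}. norm (interp G (U p G) t - Uinf t)) \<longlongrightarrow> L p) (refining T)) \<and>
    (L \<longlongrightarrow> 0) at_top"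
proof -
  let ?A = "K_hat idx K"
  have idx_mem: "idx i \<in> {1..CARD('n)}" for i
    using bij_betw_apply[OF idx UNIV_I] .
  have sym: "?A i j = ?A j i" for i j
    unfolding K_hat_def by (rule cell_avg_commute[OF idx_mem idx_mem K_sym K_measurable])
  have nonneg: "?A i j \<ge> 0" for i j
    unfolding K_hat_def by (rule cell_avg_nonneg[OF idx_mem idx_mem K_nonneg])
  define C where "C = (\<Sum>i\<in>UNIV. \<Sum>j\<in>UNIV. ?A i j) / (2 * real CARD('n))"
  have Uinf_eq: "Uinf s = g" if "s \<in> {0..T}" for s
    using strong_solution_normal_cone_const[OF Uinf g that] .
  have "\<exists>L. 0 \<le> L \<and> L \<le> sqrt (2 * T * (C / p)) \<and>
      ((\<lambda>G. SUP t\<in>{0..T}. norm (interp G (U p G) t - Uinf t)) \<longlongrightarrow> L) (refining T)" if p: "p > 1" for p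
  proof -
    interpret gradient_flow "p_laplacian ?A p" "p_energy ?A p"
      using p_laplacian_subgradient[OF p sym nonneg] p_energy_nonneg[OF p nonneg]
        bounded_p_laplacian[OF p] by unfold_locales
    obtain L where L: "0 \<le> L" "L \<le> sqrt (2 * T * p_energy ?A p g)"
      "((\<lambda>G. SUP s\<in>{0..T}. norm (interp G (U p G) s - g)) \<longlongrightarrow> L) (refining T)"
      using euler_limit[OF T solves_scheme_imp_euler[OF _ U[OF p]]] .
    have "p_energy ?A p g \<le> C / p"
      unfolding C_def by (rule p_energy_le_S_inf[OF p nonneg g])
    then have "sqrt (2 * T * p_energy ?A p g) \<le> sqrt (2 * T * (C / p))"
      using T by (intro real_sqrt_le_mono mult_left_mono) auto
    with L(2) have "L \<le> sqrt (2 * T * (C / p))" by (rule order_trans)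
    moreover have "(\<lambda>G. SUP s\<in>{0..T}. norm (interp G (U p G) s - g))
        = (\<lambda>G. SUP s\<in>{0..T}. norm (interp G (U p G) s - Uinf s))"
      using Uinf_eq by (intro ext SUP_cong) auto
    ultimately show ?thesis using L(1,3) by (intro exI[of _ L] conjI) simp_all
  qed
  then have "\<forall>p\<in>{1<..}. \<exists>L. 0 \<le> L \<and> L \<le> sqrt (2 * T * (C / p)) \<and>
      ((\<lambda>G. SUP t\<in>{0..T}. norm (interp G (U p G) t - Uinf t)) \<longlongrightarrow> L) (refining T)"
    by simp
  from bchoice[OF this] obtain L where L: "\<forall>p\<in>{1<..}. 0 \<le> L p \<and> L p \<le> sqrt (2 * T * (C / p)) \<and>
      ((\<lambda>G. SUP t\<in>{0..T}. norm (interp G (U p G) t - Uinf t)) \<longlongrightarrow> L p) (refining T)" ..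
  have "((\<lambda>p. C / p) \<longlongrightarrow> 0) at_top"
    by (intro tendsto_divide_0[OF tendsto_const] filterlim_at_top_imp_at_infinity filterlim_ident)
  then have "((\<lambda>p. sqrt (2 * T * (C / p))) \<longlongrightarrow> sqrt (2 * T * 0)) at_top"
    by (intro tendsto_intros)
  then have lim: "((\<lambda>p. sqrt (2 * T * (C / p))) \<longlongrightarrow> 0) at_top" by simp
  have "eventually (\<lambda>p. 0 \<le> L p) at_top" "eventually (\<lambda>p. L p \<le> sqrt (2 * T * (C / p))) at_top"
    using eventually_gt_at_top[of 1] by (eventually_elim; use L in simp)+
  then have "(L \<longlongrightarrow> 0) at_top"
    by (rule tendsto_sandwich[OF _ _ tendsto_const lim])
  with L show ?thesis by (intro exI[of _ L]) simp
qed

end
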